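(* Let $m$, $n$, $k$ be integers. The homogeneous space of real $m\times n$ matrices of rank $k$, under the action of $\mathrm{GL}(m)\times\mathrm{GL}(n)$ given by $(A,B)\cdot M=AMB^{-1}$, has a connection if and only if $m=n=k$, in which case it is the Cartan--Schouten manifold for $\mathrm{GL}(k)$.
   Context: For a Lie group $G$ with Lie algebra $\mathfrak g$ acting smoothly and transitively on a manifold $\mathcal M$ (infinitesimal action $\xi\cdot x\in T_x\mathcal M$, tangent map $Tg$ of $x\mapsto g\cdot x$, adjoint action $g\cdot\xi=g\xi g^{-1}$ on $\mathfrak g$), a connection is a $\mathfrak g$-valued one-form $\omega\in\Omega^1(\mathcal M,\mathfrak g)$ such that $\langle\omega,f\rangle_x\cdot x=f$ for all $x\in\mathcal M$, $f\in T_x\mathcal M$, and $\langle\omega,Tg\,f\rangle_{g\cdot x}=g\cdot\langle\omega,f\rangle_x$ for all $g\in G$. Equivalently, if $H$ is the isotropy group of a point with Lie algebra $\mathfrak h$, a connection corresponds to a reductive structure: a subspace $\mathfrak m\subset\mathfrak g$ with $\mathfrak g=\mathfrak h\oplus\mathfrak m$ and $H\cdot\mathfrak m\subset\mathfrak m$. The Cartan--Schouten manifold for a Lie group $K$ is the homogeneous space $\mathcal M=K$ with symmetry group $K\times K$ acting by $(g_1,g_2)\cdot g=g_1\,g\,g_2^{-1}$.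
   Formalization: The rank k is assumed to be at least 1 (and at most m and n, so that the space is nonempty): for k = 0 the space is the single point 0, which carries the zero connection for all m and n, so the claim fails there. *)

theory Defs
  imports "HOL-Analysis.Analysis" "HOL-Algebra.Group"
begin

text \<open>
  Manifolds and Lie groups are represented as embedded submanifolds of Euclidean spaces.
  The definitions below are meant for sets that are embedded submanifolds; for these they
  agree with the intrinsic notions.
\<close>


subsection \<open>Smooth maps and tangent vectors\<close>

text \<open>\<open>C_k_on\<close> and \<open>smooth_on\<close> are used for open \<open>U\<close> only, hence the
  derivative at \<open>x\<close> without restriction to \<open>U\<close>.\<close>

primrec C_k_on ::
    "nat \<Rightarrow> ('a::real_normed_vector \<Rightarrow> 'b::real_normed_vector) \<Rightarrow> 'a set \<Rightarrow> bool" where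
  "C_k_on 0 f U \<longleftrightarrow> continuous_on U f"
| "C_k_on (Suc k) f U \<longleftrightarrow>
     (\<forall>x\<in>U. f differentiable (at x)) \<and> (\<forall>v. C_k_on k (\<lambda>x. frechet_derivative f (at x) v) U)"

definition smooth_on ::
    "('a::real_normed_vector \<Rightarrow> 'b::real_normed_vector) \<Rightarrow> 'a set \<Rightarrow> bool" where
  "smooth_on f U \<longleftrightarrow> (\<forall>k. C_k_on k f U)"

text \<open>On a submanifold, a map is smooth if it extends locally to a smooth map of the
  ambient space.\<close>

definition smooth_map_on ::
    "'a::euclidean_space set \<Rightarrow> ('a \<Rightarrow> 'b::euclidean_space) \<Rightarrow> bool" where
  "smooth_map_on S F \<longleftrightarrow>
     (\<forall>x\<in>S. \<exists>U F'. open U \<and> x \<in> U \<and> smooth_on F' U \<and> (\<forall>y\<in>S \<inter> U. F' y = F y))"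

definition diffeo :: "'a::euclidean_space set \<Rightarrow> 'b::euclidean_space set \<Rightarrow> ('a \<Rightarrow> 'b) \<Rightarrow> bool" where
  "diffeo S T F \<longleftrightarrow>
     bij_betw F S T \<and> smooth_map_on S F \<and> smooth_map_on T (inv_into S F)"

text \<open>\<open>\<gamma>\<close> is a smooth curve in \<open>S\<close> with position \<open>x\<close> and velocity \<open>v\<close> at time \<open>0\<close>.\<close>

definition curve_at :: "'a::euclidean_space set \<Rightarrow> 'a \<Rightarrow> 'a \<Rightarrow> (real \<Rightarrow> 'a) \<Rightarrow> bool" where
  "curve_at S x v \<gamma> \<longleftrightarrow>
     (\<exists>e>0. smooth_on \<gamma> {-e<..<e} \<and> \<gamma> ` {-e<..<e} \<subseteq> S) \<and>
     \<gamma> 0 = x \<and> (\<gamma> has_vector_derivative v) (at 0)"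

definition tangent_space :: "'a::euclidean_space set \<Rightarrow> 'a \<Rightarrow> 'a set" where
  "tangent_space S x = {v. \<exists>\<gamma>. curve_at S x v \<gamma>}"

definition tangent_map ::
    "'a::euclidean_space set \<Rightarrow> ('a \<Rightarrow> 'b::euclidean_space) \<Rightarrow> 'a \<Rightarrow> 'a \<Rightarrow> 'b" where
  "tangent_map S F x v =
     (THE w. \<forall>\<gamma>. curve_at S x v \<gamma> \<longrightarrow> ((\<lambda>t. F (\<gamma> t)) has_vector_derivative w) (at 0))"


subsection \<open>Homogeneous spaces and connections\<close>

text \<open>The data of a homogeneous space: the symmetry group, the manifold, and the action.\<close>

record ('g, 'x) homogeneous_space =
  sym_group :: "'g monoid"
  points :: "'x set"
  action :: "'g \<Rightarrow> 'x \<Rightarrow> 'x"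

definition lie_algebra :: "'g::euclidean_space monoid \<Rightarrow> 'g set" where
  "lie_algebra G = tangent_space (carrier G) \<one>\<^bsub>G\<^esub>"

definition Ad :: "'g::euclidean_space monoid \<Rightarrow> 'g \<Rightarrow> 'g \<Rightarrow> 'g" where
  "Ad G g = tangent_map (carrier G) (\<lambda>h. g \<otimes>\<^bsub>G\<^esub> h \<otimes>\<^bsub>G\<^esub> inv\<^bsub>G\<^esub> g) \<one>\<^bsub>G\<^esub>"

definition inf_action ::
    "('g::euclidean_space, 'x::euclidean_space) homogeneous_space \<Rightarrow> 'g \<Rightarrow> 'x \<Rightarrow> 'x" where
  "inf_action X \<xi> x =
     tangent_map (carrier (sym_group X)) (\<lambda>g. action X g x) \<one>\<^bsub>sym_group X\<^esub> \<xi>"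

text \<open>A smooth one-form on \<open>S\<close> with values in the subspace \<open>V\<close>. Only the values
  \<open>\<omega> x f\<close> with \<open>x \<in> S\<close> and \<open>f\<close> tangent to \<open>S\<close> at \<open>x\<close> are
  relevant. Smoothness means that \<open>\<omega>\<close> is locally the restriction of a smooth field of
  linear maps on the ambient space.\<close>

definition one_form ::
    "'x::euclidean_space set \<Rightarrow> 'g::euclidean_space set \<Rightarrow> ('x \<Rightarrow> 'x \<Rightarrow> 'g) \<Rightarrow> bool" where
  "one_form S V \<omega> \<longleftrightarrow>
     (\<forall>x\<in>S. \<forall>f\<in>tangent_space S x. \<omega> x f \<in> V) \<and>
     (\<forall>x\<in>S. \<forall>f\<in>tangent_space S x. \<forall>f'\<in>tangent_space S x. \<forall>a b.
        \<omega> x (a *\<^sub>R f + b *\<^sub>R f') = a *\<^sub>R \<omega> x f + b *\<^sub>R \<omega> x f') \<and>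
     (\<forall>x\<in>S. \<exists>U (W :: 'x \<Rightarrow> 'x \<Rightarrow>\<^sub>L 'g). open U \<and> x \<in> U \<and> smooth_on W U \<and>
        (\<forall>y\<in>S \<inter> U. \<forall>f\<in>tangent_space S y. blinfun_apply (W y) f = \<omega> y f))"

definition connection ::
    "('g::euclidean_space, 'x::euclidean_space) homogeneous_space \<Rightarrow> ('x \<Rightarrow> 'x \<Rightarrow> 'g) \<Rightarrow> bool" where
  "connection X \<omega> \<longleftrightarrow>
     one_form (points X) (lie_algebra (sym_group X)) \<omega> \<and>
     (\<forall>x\<in>points X. \<forall>f\<in>tangent_space (points X) x. inf_action X (\<omega> x f) x = f) \<and>
     (\<forall>g\<in>carrier (sym_group X). \<forall>x\<in>points X. \<forall>f\<in>tangent_space (points X) x.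
        \<omega> (action X g x) (tangent_map (points X) (action X g) x f) = Ad (sym_group X) g (\<omega> x f))"

definition has_connection ::
    "('g::euclidean_space, 'x::euclidean_space) homogeneous_space \<Rightarrow> bool" where
  "has_connection X \<longleftrightarrow> (\<exists>\<omega>. connection X \<omega>)"

definition isomorphic_homogeneous_spaces ::
    "('g::euclidean_space, 'x::euclidean_space) homogeneous_space \<Rightarrow>
     ('h::euclidean_space, 'y::euclidean_space) homogeneous_space \<Rightarrow> bool" where
  "isomorphic_homogeneous_spaces X Y \<longleftrightarrow>
     (\<exists>\<phi> \<Phi>. \<phi> \<in> iso (sym_group X) (sym_group Y) \<and>
        diffeo (carrier (sym_group X)) (carrier (sym_group Y)) \<phi> \<and>
        diffeo (points X) (points Y) \<Phi> \<and>
        (\<forall>g\<in>carrier (sym_group X). \<forall>x\<in>points X.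
           \<Phi> (action X g x) = action Y (\<phi> g) (\<Phi> x)))"


subsection \<open>Matrices of fixed rank and Cartan--Schouten manifolds\<close>

definition GL :: "(real^'n^'n) monoid" where
  "GL = \<lparr>carrier = {A. invertible A}, monoid.mult = (**), one = mat 1\<rparr>"

definition fixed_rank_space ::
    "nat \<Rightarrow> ((real^'m^'m) \<times> (real^'n^'n), real^'n^'m) homogeneous_space" where
  "fixed_rank_space k =
     \<lparr>sym_group = GL \<times>\<times> GL,
      points = {M. rank M = k},
      action = (\<lambda>(A, B) M. A ** M ** matrix_inv B)\<rparr>"

definition cartan_schouten :: "'g monoid \<Rightarrow> ('g \<times> 'g, 'g) homogeneous_space" where
  "cartan_schouten K =
     \<lparr>sym_group = K \<times>\<times> K,
      points = carrier K,
      action = (\<lambda>(g\<^sub>1, g\<^sub>2) g. g\<^sub>1 \<otimes>\<^bsub>K\<^esub> g \<otimes>\<^bsub>K\<^esub> inv\<^bsub>K\<^esub> g\<^sub>2)\<rparr>"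

end

theory Submission
  imports Defs
begin

text \<open>
  If \<open>m = n = k\<close>, the points are the invertible matrices and \<open>\<omega>\<^sub>M f = (f M\<^sup>-\<^sup>1, 0)\<close> is a
  connection; a choice of bijections between the index types gives the isomorphism.

  Conversely, let \<open>\<omega>\<close> be a connection and \<open>k < m\<close>. For \<open>M\<close> of rank \<open>k\<close> choose \<open>u \<noteq> 0\<close> with
  \<open>u\<^sup>T M = 0\<close> and \<open>v = M w \<noteq> 0\<close>. The unipotent elements \<open>(1 + t F, 1)\<close> with \<open>F = v u\<^sup>T\<close> fix \<open>M\<close> and
  move the tangent vector \<open>f = u v\<^sup>T M\<close> along a line, so that \<open>\<omega>\<^sub>M\<close> of it is affine in \<open>t\<close>. But if
  \<open>\<omega>\<^sub>M f = (\<xi>, \<eta>)\<close>, then the adjoint action on \<open>\<xi>\<close> has the quadratic term \<open>- t\<^sup>2 F \<xi> F\<close>. So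
  \<open>F \<xi> F = (u\<^sup>T \<xi> v) F\<close> vanishes, whereas \<open>\<xi> M - M \<eta> = f\<close> forces \<open>u\<^sup>T \<xi> v = |u|\<^sup>2 |v|\<^sup>2 > 0\<close>.
  The case \<open>k < n\<close> is the transpose of this one.
\<close>

subsection \<open>Smooth maps\<close>

text \<open>Openness of \<open>U\<close> makes derivatives at its points depend only on the values
  taken on \<open>U\<close>.\<close>

lemma C_k_on_cong:
  assumes "open U" "\<And>x. x \<in> U \<Longrightarrow> f x = g x" "C_k_on k f U"
  shows "C_k_on k g U"
  using assms(2,3)
proof (induction k arbitrary: f g)
  case 0
  then show ?case by (simp cong: continuous_on_cong)
next
  case (Suc k)
  have "(g has_derivative frechet_derivative f (at x)) (at x)" if "x \<in> U" for x
    using Suc.prems that assms(1)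
    by (auto intro: has_derivative_transform_within_open simp: frechet_derivative_works)
  then have "g differentiable (at x)" "frechet_derivative f (at x) = frechet_derivative g (at x)"
    if "x \<in> U" for x
    using that by (auto simp: differentiable_def dest: frechet_derivative_at)
  then show ?case
    using Suc.IH[of "\<lambda>x. frechet_derivative f (at x) v" "\<lambda>x. frechet_derivative g (at x) v" for v]
      Suc.prems by auto
qed

text \<open>\<open>C_k_on\<close> recurses through \<open>frechet_derivative\<close>. Derivatives at
  a point are unique, so any known derivative \<open>f'\<close> may stand in for it.\<close>

lemma C_k_on_SucI:
  assumes "open U" "\<And>x. x \<in> U \<Longrightarrow> (f has_derivative f' x) (at x)"
    and "\<And>v. C_k_on k (\<lambda>x. f' x v) U"
  shows "C_k_on (Suc k) f U"
proof -
  have "f' x = frechet_derivative f (at x)" if "x \<in> U" for x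
    using assms(2)[OF that] by (rule frechet_derivative_at)
  then have "C_k_on k (\<lambda>x. frechet_derivative f (at x) v) U" for v
    by (intro C_k_on_cong[OF assms(1) _ assms(3)[of v]]) simp
  then show ?thesis
    using assms(2) by (auto simp: differentiable_def)
qed

lemma C_k_on_SucD: "C_k_on (Suc k) f U \<Longrightarrow> C_k_on k f U"
proof (induction k arbitrary: f)
  case 0
  then show ?case
    by (auto simp: continuous_on_eq_continuous_at intro!: continuous_at_imp_continuous_on
        differentiable_imp_continuous_within)
qed auto

lemma C_k_on_const: "C_k_on k (\<lambda>x. c) U"
  by (induction k arbitrary: c) auto

lemma C_k_on_ident: "open U \<Longrightarrow> C_k_on k (\<lambda>x. x) U"
  by (cases k) (auto intro!: C_k_on_SucI[where f' = "\<lambda>x v. v"] C_k_on_const derivative_intros simp del: C_k_on.simps(2))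

lemma C_k_on_add:
  assumes "open U" "C_k_on k f U" "C_k_on k g U"
  shows "C_k_on k (\<lambda>x. f x + g x) U"
  using assms(2,3)
proof (induction k arbitrary: f g)
  case 0
  then show ?case by (auto intro: continuous_intros)
next
  case (Suc k)
  then show ?case
    by (intro C_k_on_SucI[where f' = "\<lambda>x v. frechet_derivative f (at x) v + frechet_derivative g (at x) v"]
        assms(1)) (auto intro!: derivative_intros simp: frechet_derivative_works)
qed

lemma C_k_on_bounded_linear:
  assumes "open U" "bounded_linear L" "C_k_on k f U"
  shows "C_k_on k (\<lambda>x. L (f x)) U"
  using assms(3)
proof (induction k arbitrary: f)
  case 0
  then show ?case by (auto intro: bounded_linear.continuous_on[OF assms(2)])
next
  case (Suc k)
  then show ?case
    by (intro C_k_on_SucI[where f' = "\<lambda>x v. L (frechet_derivative f (at x) v)"] assms(1))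
       (auto intro!: bounded_linear.has_derivative[OF assms(2)] simp: frechet_derivative_works)
qed

lemma C_k_on_bounded_bilinear:
  assumes "open U" "bounded_bilinear p" "C_k_on k f U" "C_k_on k g U"
  shows "C_k_on k (\<lambda>x. p (f x) (g x)) U"
  using assms(3,4)
proof (induction k arbitrary: f g)
  case 0
  then show ?case by (auto intro: bounded_bilinear.continuous_on[OF assms(2)])
next
  case (Suc k)
  \<comment> \<open>The product rule leaves one factor undifferentiated, so the induction hypothesis
    is also applied to \<open>f\<close> and \<open>g\<close> themselves.\<close>
  have "C_k_on k f U" "C_k_on k g U"
    using Suc.prems by (blast dest: C_k_on_SucD)+
  with Suc show ?case
    by (intro C_k_on_SucI[where f' = "\<lambda>x v. p (f x) (frechet_derivative g (at x) v)
          + p (frechet_derivative f (at x) v) (g x)"] assms(1))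
       (auto intro!: bounded_bilinear.FDERIV[OF assms(2)] C_k_on_add assms(1)
         simp: frechet_derivative_works)
qed

lemma smooth_on_bounded_linear: "open U \<Longrightarrow> bounded_linear L \<Longrightarrow> smooth_on L U"
  unfolding smooth_on_def using C_k_on_bounded_linear[OF _ _ C_k_on_ident] by blast

lemma smooth_on_line: "open U \<Longrightarrow> smooth_on (\<lambda>t. x + t *\<^sub>R v) U"
  unfolding smooth_on_def
  by (intro allI C_k_on_add C_k_on_const C_k_on_bounded_linear[OF _ bounded_linear_scaleR_left] C_k_on_ident)


subsection \<open>The inverse of a matrix\<close>

lemma bounded_bilinear_matrix_mult:
  "bounded_bilinear ((**) :: real^'n^'m \<Rightarrow> real^'p^'n \<Rightarrow> real^'p^'m)"
  unfolding bilinear_conv_bounded_bilinear[symmetric] bilinear_def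
  by (auto intro!: linearI
      simp: matrix_matrix_mult_def vec_eq_iff sum.distrib sum_distrib_left algebra_simps)

interpretation matrix_mult: bounded_bilinear "(**) :: real^'n^'m \<Rightarrow> real^'p^'n \<Rightarrow> real^'p^'m"
  by (rule bounded_bilinear_matrix_mult)

lemma matrix_inv:
  assumes "invertible A"
  shows matrix_inv_right: "A ** matrix_inv A = mat 1"
    and matrix_inv_left: "matrix_inv A ** A = mat 1"
  using someI_ex[OF assms[unfolded invertible_def]] unfolding matrix_inv_def by auto

lemma matrix_inv_unique:
  assumes "A ** B = mat 1" "B ** A = mat 1"
  shows "matrix_inv A = B"
proof -
  have "invertible A" using assms invertible_def by blast
  then have "matrix_inv A ** (A ** B) = B"
    by (simp add: matrix_mul_assoc matrix_inv)
  then show ?thesis using assms by simp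
qed

lemma invertible_mat_1: "invertible (mat 1 :: real^'n^'n)"
  by (auto simp: invertible_def intro: exI[of _ "mat 1"])

lemma invertible_matrix_inv: "invertible A \<Longrightarrow> invertible (matrix_inv A)"
  using invertible_def matrix_inv by blast

text \<open>\<open>'m\<close> and \<open>'n\<close> may differ, so \<open>det\<close> does not apply
  to these matrices directly. Near an invertible \<open>A\<close> it is applied to the square matrix
  \<open>Y ** matrix_inv A\<close>, which is the identity at \<open>Y = A\<close>.\<close>

lemma open_invertible: "open {A :: real^'n^'m. invertible A}"
proof (subst open_subopen, safe)
  fix A :: "real^'n^'m" assume A: "invertible A"
  let ?T = "(\<lambda>Y. det (Y ** matrix_inv A)) -` (- {0})"
  have "open ?T"
    unfolding det_def
    by (intro open_vimage) (auto intro!: continuous_intros matrix_mult.continuous_on)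
  moreover have "A \<in> ?T" using A by (simp add: matrix_inv)
  moreover have "invertible Y" if "Y \<in> ?T" for Y
  proof -
    have "invertible (Y ** matrix_inv A ** A)"
      using that A by (intro invertible_mult[of "Y ** matrix_inv A" A]) (auto simp: invertible_det_nz)
    then show ?thesis using A by (simp add: matrix_inv flip: matrix_mul_assoc)
  qed
  ultimately show "\<exists>T. open T \<and> A \<in> T \<and> T \<subseteq> {A. invertible A}" by blast
qed

text \<open>With \<open>D = matrix_inv Y - matrix_inv A\<close> one has
  \<open>D = - p (Y - A) (matrix_inv Y)\<close>. The error of the linear approximation is therefore
  \<open>- p (Y - A) D\<close>, which is quadratic in \<open>Y - A\<close> once
  \<open>norm D\<close> is bounded by a multiple of \<open>norm (Y - A)\<close>.\<close>

lemma has_derivative_matrix_inv: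
  fixes A :: "real^'n^'m"
  assumes A: "invertible A"
  shows "(matrix_inv has_derivative (\<lambda>V. - (matrix_inv A ** V ** matrix_inv A))) (at A)"
proof -
  define p where "p V D = matrix_inv A ** V ** D" for V :: "real^'n^'m" and D :: "real^'m^'n"
  have bl: "bounded_linear (\<lambda>V. - (matrix_inv A ** V ** matrix_inv A))"
    by (intro bounded_linear_minus bounded_linear_compose[OF matrix_mult.bounded_linear_left]
        matrix_mult.bounded_linear_right)
  have "bounded_bilinear p"
    unfolding p_def
    by (rule bounded_bilinear.comp[OF bounded_bilinear_matrix_mult matrix_mult.bounded_linear_right bounded_linear_ident])
  then obtain b where b: "b > 0" "norm (p V D) \<le> norm V * norm D * b" for V D
    using bounded_bilinear.pos_bounded by blast
  obtain e where e: "e > 0" "ball A e \<subseteq> {A. invertible A}"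
    using open_invertible[where 'm = 'm and 'n = 'n] A openE by blast
  \<comment> \<open>Within distance \<open>e\<close> the matrix \<open>Y\<close> is invertible. The
    bound \<open>1 / (2 * b)\<close> makes \<open>norm (p (Y - A) D)\<close> at most half of
    \<open>norm D\<close>, so that it can be absorbed in the estimate of
    \<open>norm D\<close>.\<close>
  define r where "r = min e (1 / (2 * b))"
  define a where "a = norm (matrix_inv A) * b"
  show ?thesis
  proof (rule has_derivativeI_sandwich[where e = r and H = "\<lambda>Y. 2 * a * b * norm (Y - A)"])
    show "r > 0" using e b by (simp add: r_def)
    show "bounded_linear (\<lambda>V. - (matrix_inv A ** V ** matrix_inv A))" by (rule bl)
    show "((\<lambda>Y. 2 * a * b * norm (Y - A)) \<longlongrightarrow> 0) (at A)"
      by (auto intro!: tendsto_eq_intros)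
  next
    fix Y assume "Y \<noteq> A" "dist Y A < r"
    then have Y: "Y \<noteq> A" "invertible Y" "norm (Y - A) < 1 / (2 * b)"
      using e(2) by (auto simp: r_def dist_norm norm_minus_commute)
    define D where "D = matrix_inv Y - matrix_inv A"
    have D1: "D = - p (Y - A) (matrix_inv Y)"
      using A Y(2) by (simp add: D_def p_def matrix_mult.diff_left matrix_mult.diff_right matrix_inv
          flip: matrix_mul_assoc)
    have "p (Y - A) D = p (Y - A) (matrix_inv Y) - p (Y - A) (matrix_inv A)"
      by (simp add: p_def D_def matrix_mult.diff_right)
    with D1 have D2: "D + p (Y - A) (matrix_inv A) = - p (Y - A) D"
      by simp
    have "D = - p (Y - A) D - p (Y - A) (matrix_inv A)"
      using D2 by (simp only: eq_diff_eq)
    then have "norm D \<le> norm (p (Y - A) (matrix_inv A)) + norm (p (Y - A) D)"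
      by (metis norm_triangle_ineq4 norm_minus_cancel add.commute)
    also have "\<dots> \<le> a * norm (Y - A) + (norm (Y - A) * b) * norm D"
      using b(2)[of "Y - A" "matrix_inv A"] b(2)[of "Y - A" D] by (simp add: a_def mult_ac)
    also have "(norm (Y - A) * b) * norm D \<le> 1/2 * norm D"
      using Y(3) b(1) by (intro mult_right_mono) (auto simp: field_simps)
    finally have D3: "norm D \<le> 2 * a * norm (Y - A)" by simp
    have "norm (p (Y - A) D) \<le> norm (Y - A) * (2 * a * norm (Y - A)) * b"
      using b(1) by (intro order_trans[OF b(2)] mult_right_mono mult_left_mono D3) auto
    then have "norm (D + p (Y - A) (matrix_inv A)) / norm (Y - A) \<le> 2 * a * b * norm (Y - A)"
      using Y(1) D2 by (simp add: field_simps)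
    then show "norm (matrix_inv Y - matrix_inv A - - (matrix_inv A ** (Y - A) ** matrix_inv A))
        / norm (Y - A) \<le> 2 * a * b * norm (Y - A)"
      by (simp add: D_def p_def)
  qed
qed

text \<open>Bootstrapping: the derivative is built from \<open>matrix_inv\<close> itself by products
  and a sign, so each order of smoothness yields the next.\<close>

lemma smooth_on_matrix_inv: "smooth_on matrix_inv {A :: real^'n^'m. invertible A}"
  unfolding smooth_on_def
proof
  fix k
  show "C_k_on k matrix_inv {A :: real^'n^'m. invertible A}"
  proof (induction k)
    case 0
    show ?case
      by (auto intro!: continuous_at_imp_continuous_on has_derivative_continuous has_derivative_matrix_inv)
  next
    case (Suc k)
    show ?case
      by (rule C_k_on_SucI[OF open_invertible has_derivative_matrix_inv])
        (auto intro!: Suc.IH open_invertible C_k_on_bounded_bilinear[OF _ bounded_bilinear_matrix_mult]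
          C_k_on_bounded_linear[OF _ bounded_linear_minus[OF bounded_linear_ident]] C_k_on_const)
  qed
qed


subsection \<open>Tangent spaces and infinitesimal actions\<close>

text \<open>Straight lines inside the manifold give all the tangent vectors that the case of
  deficient rank needs; the full tangent spaces are not determined there.\<close>

lemma curve_at_line:
  assumes "\<And>t. x + t *\<^sub>R v \<in> S"
  shows "v \<in> tangent_space S x"
  unfolding tangent_space_def curve_at_def
  by (rule CollectI, rule exI[of _ "\<lambda>t. x + t *\<^sub>R v"])
    (auto intro!: smooth_on_line exI[of _ 1] assms derivative_eq_intros)

lemma tangent_space_open:
  assumes "open S" "x \<in> S"
  shows "tangent_space S x = UNIV"
proof -
  have "v \<in> tangent_space S x" for v
  proof -
    have "open ((\<lambda>t. x + t *\<^sub>R v) -` S)"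
      by (intro open_vimage assms continuous_intros)
    moreover have "0 \<in> (\<lambda>t. x + t *\<^sub>R v) -` S" using assms by simp
    ultimately obtain e where e: "e > 0" "ball 0 e \<subseteq> (\<lambda>t. x + t *\<^sub>R v) -` S"
      using openE by blast
    then have "(\<lambda>t. x + t *\<^sub>R v) ` {-e<..<e} \<subseteq> S"
      by (auto simp: subset_eq)
    then have "curve_at S x v (\<lambda>t. x + t *\<^sub>R v)"
      using e(1) unfolding curve_at_def
      by (auto intro!: smooth_on_line exI[of _ e] derivative_eq_intros)
    then show ?thesis unfolding tangent_space_def by blast
  qed
  then show ?thesis by blast
qed

text \<open>By the chain rule every curve has the same image velocity \<open>F' v\<close>. Tangency
  of \<open>v\<close> supplies at least one curve, which pins down the definite description.\<close>

lemma tangent_map_eq: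
  assumes F: "(F has_derivative F') (at x)" and v: "v \<in> tangent_space S x"
  shows "tangent_map S F x v = F' v"
proof -
  have *: "((\<lambda>t. F (\<gamma> t)) has_vector_derivative F' v) (at 0)" if "curve_at S x v \<gamma>" for \<gamma>
    using that F vector_derivative_diff_chain_within[of \<gamma> v 0 UNIV F F']
    by (auto simp: curve_at_def o_def intro: has_derivative_at_withinI)
  obtain \<gamma> where "curve_at S x v \<gamma>" using v unfolding tangent_space_def by blast
  with * show ?thesis
    unfolding tangent_map_def
    by (intro the_equality) (auto intro: vector_derivative_unique_at)
qed

section \<open>The groups \<open>GL\<close>, their adjoint action and the action on matrices\<close>

lemma group_GL: "group (GL :: (real^'n^'n) monoid)"
proof (rule groupI)
  fix A :: "real^'n^'n" assume "A \<in> carrier GL"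
  then have "matrix_inv A \<in> carrier GL" "matrix_inv A \<otimes>\<^bsub>GL\<^esub> A = \<one>\<^bsub>GL\<^esub>"
    by (auto simp: GL_def invertible_matrix_inv matrix_inv)
  then show "\<exists>B\<in>carrier GL. B \<otimes>\<^bsub>GL\<^esub> A = \<one>\<^bsub>GL\<^esub>" by blast
qed (auto simp: GL_def invertible_mult matrix_mul_assoc invertible_mat_1)

lemma inv_GL: "invertible A \<Longrightarrow> inv\<^bsub>GL\<^esub> A = matrix_inv A" for A :: "real^'n^'n"
  by (rule group.inv_equality[OF group_GL]) (auto simp: GL_def invertible_matrix_inv matrix_inv)

lemma carrier_GL: "carrier GL = {A. invertible A}"
  and one_GL: "\<one>\<^bsub>GL\<^esub> = mat 1"
  and mult_GL: "A \<otimes>\<^bsub>GL\<^esub> B = A ** B"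
  by (simp_all add: GL_def)

lemma inv_GL_prod:
  "invertible A \<Longrightarrow> invertible B \<Longrightarrow> inv\<^bsub>GL \<times>\<times> GL\<^esub> (A, B) = (matrix_inv A, matrix_inv B)"
  for A :: "real^'m^'m" and B :: "real^'n^'n"
  by (simp add: group_GL carrier_GL inv_GL)

lemma lie_algebra_GL_prod:
  "lie_algebra (GL \<times>\<times> GL :: ((real^'m^'m) \<times> (real^'n^'n)) monoid) = UNIV"
  unfolding lie_algebra_def
  by (rule tangent_space_open)
    (auto simp: carrier_GL one_GL intro!: open_Times open_invertible invertible_mat_1)

lemma bounded_linear_sandwich: "bounded_linear (\<lambda>X :: real^'n^'m. A ** X ** B)"
  by (rule bounded_linear_compose[OF matrix_mult.bounded_linear_left matrix_mult.bounded_linear_right])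

text \<open>Conjugation is the restriction of a linear map of the ambient space, which is its own
  derivative.\<close>

lemma Ad_GL_prod:
  fixes A :: "real^'m^'m" and B :: "real^'n^'n"
  assumes "invertible A" "invertible B"
  shows "Ad (GL \<times>\<times> GL) (A, B) \<xi> = (A ** fst \<xi> ** matrix_inv A, B ** snd \<xi> ** matrix_inv B)"
proof -
  let ?F = "\<lambda>h. (A ** fst h ** matrix_inv A, B ** snd h ** matrix_inv B)"
  have "(\<lambda>h. (A, B) \<otimes>\<^bsub>GL \<times>\<times> GL\<^esub> h \<otimes>\<^bsub>GL \<times>\<times> GL\<^esub> inv\<^bsub>GL \<times>\<times> GL\<^esub> (A, B)) = ?F"
    using assms by (auto simp: inv_GL_prod mult_GL simp del: inv_DirProd)
  moreover have "bounded_linear ?F"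
    by (intro bounded_linear_Pair bounded_linear_compose[OF bounded_linear_sandwich]
        bounded_linear_fst bounded_linear_snd)
  ultimately show ?thesis
    using lie_algebra_GL_prod unfolding Ad_def lie_algebra_def
    by (subst tangent_map_eq[where F' = ?F]) (auto intro: bounded_linear_imp_has_derivative)
qed

text \<open>This is the product rule at the identity. The minus sign is the derivative of inversion
  there.\<close>

lemma inf_action_fixed_rank_space:
  fixes M :: "real^'n^'m"
  shows "inf_action (fixed_rank_space k) \<xi> M = fst \<xi> ** M - M ** snd \<xi>"
proof -
  let ?F = "\<lambda>g :: (real^'m^'m) \<times> (real^'n^'n). fst g ** M ** matrix_inv (snd g)"
  have 1: "matrix_inv (mat 1 :: real^'n^'n) = mat 1"
    by (simp add: matrix_inv_unique)
  have D: "(matrix_inv has_derivative uminus) (at (mat 1 :: real^'n^'n))"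
    using has_derivative_matrix_inv[OF invertible_mat_1[where 'n = 'n]] by (simp add: 1)
  have snd: "((\<lambda>g. matrix_inv (snd g)) has_derivative (\<lambda>\<xi>. - snd \<xi>)) (at (mat 1 :: real^'m^'m, mat 1 :: real^'n^'n))"
    by (rule has_derivative_compose[where g = matrix_inv and g' = uminus,
          OF bounded_linear_imp_has_derivative[OF bounded_linear_snd]]) (simp add: D)
  have fst: "((\<lambda>g. fst g ** M) has_derivative (\<lambda>\<xi>. fst \<xi> ** M)) (at (mat 1 :: real^'m^'m, mat 1 :: real^'n^'n))"
    by (intro bounded_linear_imp_has_derivative
        bounded_linear_compose[OF matrix_mult.bounded_linear_left bounded_linear_fst])
  have "(?F has_derivative (\<lambda>\<xi>. fst \<xi> ** M - M ** snd \<xi>)) (at (mat 1, mat 1))"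
    using matrix_mult.FDERIV[OF fst snd] by (simp add: 1 matrix_mult.minus_right)
  then show ?thesis
    using lie_algebra_GL_prod unfolding inf_action_def lie_algebra_def fixed_rank_space_def
    by (simp add: one_GL case_prod_beta) (subst tangent_map_eq, auto simp: one_GL)
qed

lemma tangent_map_fixed_rank_space:
  assumes "f \<in> tangent_space S M"
  shows "tangent_map S (action (fixed_rank_space k) (A, B)) M f = A ** f ** matrix_inv B"
  unfolding fixed_rank_space_def
  by (simp, rule tangent_map_eq[OF bounded_linear_imp_has_derivative[OF bounded_linear_sandwich] assms])

lemma points_fixed_rank_space: "points (fixed_rank_space k) = {M. rank M = k}"
  and sym_group_fixed_rank_space: "sym_group (fixed_rank_space k) = GL \<times>\<times> GL"
  and action_fixed_rank_space: "action (fixed_rank_space k) (A, B) M = A ** M ** matrix_inv B"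
  by (simp_all add: fixed_rank_space_def)


subsection \<open>Matrices of deficient rank\<close>

lemma rank_mult_invertible:
  fixes M :: "real^'n^'m"
  assumes "invertible A" "invertible B"
  shows "rank (A ** M ** B) = rank M"
proof (rule antisym)
  show "rank (A ** M ** B) \<le> rank M"
    using rank_mul_le_left[of "A ** M" B] rank_mul_le_right[of A M] by simp
  have "M = matrix_inv A ** (A ** M ** B) ** matrix_inv B"
    using assms by (simp add: matrix_inv matrix_mul_assoc) (simp add: matrix_inv flip: matrix_mul_assoc)
  then show "rank M \<le> rank (A ** M ** B)"
    using rank_mul_le_left[of "matrix_inv A ** (A ** M ** B)" "matrix_inv B"]
      rank_mul_le_right[of "matrix_inv A" "A ** M ** B"] by simp
qed

section \<open>Unipotent isotropy elements and equivariance\<close>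

lemma square_zero_imp_unipotent:
  fixes F :: "real^'n^'n"
  assumes "F ** F = 0"
  shows "invertible (mat 1 + t *\<^sub>R F)" "matrix_inv (mat 1 + t *\<^sub>R F) = mat 1 - t *\<^sub>R F"
proof -
  have "(mat 1 + t *\<^sub>R F) ** (mat 1 - t *\<^sub>R F) = mat 1" "(mat 1 - t *\<^sub>R F) ** (mat 1 + t *\<^sub>R F) = mat 1"
    using assms
    by (simp_all add: matrix_mult.add_left matrix_mult.add_right matrix_mult.diff_left
        matrix_mult.diff_right matrix_mult.scaleR_left matrix_mult.scaleR_right)
  then show "invertible (mat 1 + t *\<^sub>R F)" "matrix_inv (mat 1 + t *\<^sub>R F) = mat 1 - t *\<^sub>R F"
    by (auto simp: invertible_def intro: matrix_inv_unique)
qed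

lemma unipotent_sandwich:
  fixes X :: "real^'n^'m"
  shows "(mat 1 + t *\<^sub>R F) ** X ** (mat 1 - t *\<^sub>R F')
    = X + t *\<^sub>R (F ** X - X ** F') - t\<^sup>2 *\<^sub>R (F ** X ** F')"
  by (simp add: matrix_mult.add_left matrix_mult.add_right matrix_mult.diff_left
        matrix_mult.diff_right matrix_mult.scaleR_left matrix_mult.scaleR_right
        algebra_simps power2_eq_square)

text \<open>The hypothesis says that \<open>x + t *\<^sub>R y - t\<^sup>2 *\<^sub>R z\<close> takes
  at \<open>t = 2\<close> the value extrapolated affinely from \<open>t = 0\<close> and
  \<open>t = 1\<close>; its second difference is \<open>-2 *\<^sub>R z\<close>. The unsimplified
  numerals match the instances of \<open>unipotent_sandwich\<close>.\<close>

lemma second_difference_quadratic: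
  fixes x y z :: "'a::real_vector"
  assumes "x + 2 *\<^sub>R y - 2\<^sup>2 *\<^sub>R z = 2 *\<^sub>R (x + 1 *\<^sub>R y - 1\<^sup>2 *\<^sub>R z) - x"
  shows "z = 0"
proof -
  have "4 *\<^sub>R z = 2 *\<^sub>R z + 2 *\<^sub>R z" by (simp flip: scaleR_left.add)
  then have "2 *\<^sub>R z = 0"
    using assms by (simp add: scaleR_add_right scaleR_diff_right scaleR_2 algebra_simps)
  then show ?thesis by simp
qed

text \<open>\<open>F1 ** M = 0\<close> and \<open>M ** F2 = 0\<close> put the unipotent pair built
  from \<open>F1\<close>, \<open>F2\<close> into the isotropy group of \<open>M\<close>, and
  \<open>F1 ** f ** F2 = 0\<close> removes the quadratic term from the motion of \<open>f\<close>.
  Equivariance then equates an affine with a quadratic function of \<open>t\<close>. Each later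
  application sets one of \<open>F1\<close>, \<open>F2\<close> to 0.\<close>

lemma connection_square_zero:
  fixes M :: "real^'n^'m" and \<omega> :: "real^'n^'m \<Rightarrow> real^'n^'m \<Rightarrow> (real^'m^'m) \<times> (real^'n^'n)"
  assumes \<omega>: "connection (fixed_rank_space k) \<omega>"
    and line: "\<And>t. rank (M + t *\<^sub>R f) = k"
    and F: "F1 ** M = 0" "M ** F2 = 0" "F1 ** F1 = 0" "F2 ** F2 = 0" "F1 ** f ** F2 = 0"
  shows "F1 ** fst (\<omega> M f) ** F1 = 0" "F2 ** snd (\<omega> M f) ** F2 = 0"
proof -
  define A B where "A t = mat 1 + t *\<^sub>R F1" and "B t = mat 1 + t *\<^sub>R F2" for t
  \<comment> \<open>This will be the image of \<open>f\<close> under the group element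
    \<open>(A t, B t)\<close>.\<close>
  define f' where "f' t = f + t *\<^sub>R (F1 ** f - f ** F2)" for t
  define T where "T = tangent_space {M :: real^'n^'m. rank M = k} M"
  have inv: "invertible (A t)" "invertible (B t)" "matrix_inv (A t) = mat 1 - t *\<^sub>R F1"
      "matrix_inv (B t) = mat 1 - t *\<^sub>R F2" for t
    using F square_zero_imp_unipotent by (auto simp: A_def B_def)
  have M: "A t ** M ** matrix_inv (B t) = M" for t
    using F by (simp add: inv(4), simp add: A_def unipotent_sandwich)
  have f: "A t ** f ** matrix_inv (B t) = f' t" for t
    using F by (simp add: inv(4), simp add: A_def unipotent_sandwich f'_def)
  have T: "f' t \<in> T" for t
    unfolding T_def
  proof (rule curve_at_line)
    fix s
    \<comment> \<open>The group element fixes \<open>M\<close> and preserves rank, so it carries the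
      line through \<open>M\<close> along \<open>f\<close> to the line along
      \<open>f' t\<close>.\<close>
    have "M + s *\<^sub>R f' t = A t ** (M + s *\<^sub>R f) ** matrix_inv (B t)"
      by (simp add: matrix_mult.add_left matrix_mult.add_right matrix_mult.scaleR_left
          matrix_mult.scaleR_right M f)
    then show "M + s *\<^sub>R f' t \<in> {M. rank M = k}"
      by (simp add: rank_mult_invertible inv(1) invertible_matrix_inv inv(2) line)
  qed
  have fT: "f \<in> T" using T[of 0] by (simp add: f'_def)
  have rM: "rank M = k" using line[of 0] by simp
  have lin: "\<omega> M (a *\<^sub>R x + b *\<^sub>R y) = a *\<^sub>R \<omega> M x + b *\<^sub>R \<omega> M y" if "x \<in> T" "y \<in> T" for x y a b
    using \<omega> rM that unfolding connection_def one_form_def T_def points_fixed_rank_space by blast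
  have equi: "\<omega> M (f' t) = (A t ** fst (\<omega> M f) ** matrix_inv (A t), B t ** snd (\<omega> M f) ** matrix_inv (B t))" for t
  proof -
    have "(A t, B t) \<in> carrier (GL \<times>\<times> GL)" by (simp add: carrier_GL inv)
    then have "\<omega> (A t ** M ** matrix_inv (B t)) (A t ** f ** matrix_inv (B t)) = Ad (GL \<times>\<times> GL) (A t, B t) (\<omega> M f)"
      using \<omega> rM fT tangent_map_fixed_rank_space[of f "{M. rank M = k}" M k "A t" "B t"]
      unfolding connection_def points_fixed_rank_space sym_group_fixed_rank_space T_def
      by (force simp: action_fixed_rank_space)
    then show ?thesis by (simp add: M f Ad_GL_prod inv(1,2))
  qed
  \<comment> \<open>Affine dependence on \<open>t\<close> enters only as this relation between the
    vectors at 0, 1 and 2, where \<open>f\<close> is \<open>f' 0\<close>. Linearity of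
    \<open>\<omega> M\<close> transports it to the Lie algebra.\<close>
  have "f' 2 = 2 *\<^sub>R f' 1 + (-1) *\<^sub>R f"
    by (simp add: f'_def algebra_simps scaleR_2)
  then have "\<omega> M (f' 2) = 2 *\<^sub>R \<omega> M (f' 1) + (-1) *\<^sub>R \<omega> M f"
    using lin[OF T fT] by metis
  then have "A 2 ** fst (\<omega> M f) ** matrix_inv (A 2)
      = 2 *\<^sub>R (A 1 ** fst (\<omega> M f) ** matrix_inv (A 1)) - fst (\<omega> M f)"
    and "B 2 ** snd (\<omega> M f) ** matrix_inv (B 2)
      = 2 *\<^sub>R (B 1 ** snd (\<omega> M f) ** matrix_inv (B 1)) - snd (\<omega> M f)"
    by (simp_all add: equi prod_eq_iff)
  then show "F1 ** fst (\<omega> M f) ** F1 = 0" "F2 ** snd (\<omega> M f) ** F2 = 0"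
    unfolding inv(3,4) unfolding A_def B_def unipotent_sandwich
    by (blast intro: second_difference_quadratic)+
qed

text \<open>The witness is the 0-1 matrix of a bijection between \<open>k\<close>-element sets of
  column and row indices. Its nonzero columns are \<open>k\<close> distinct unit vectors, and a zero
  column does not change the dimension.\<close>

lemma ex_matrix_of_rank:
  assumes "k \<le> CARD('m::finite)" "k \<le> CARD('n::finite)"
  shows "\<exists>M :: real^'n^'m. rank M = k"
proof -
  obtain J :: "'n set" where J: "card J = k"
    using obtain_subset_with_card_n[OF assms(2)] by metis
  obtain I :: "'m set" where I: "card I = k"
    using obtain_subset_with_card_n[OF assms(1)] by metis
  obtain h where h: "bij_betw h J I"
    using finite_same_card_bij[of J I] I J by auto
  define B :: "(real^'m) set" where "B = (\<lambda>i. axis i 1) ` I"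
  define M :: "real^'n^'m" where "M = (\<chi> i j. if j \<in> J \<and> i = h j then 1 else 0)"
  have col: "column j M = (if j \<in> J then axis (h j) 1 else 0)" for j
    by (auto simp: column_def M_def vec_eq_iff axis_def)
  have "columns M \<subseteq> insert 0 B" "B \<subseteq> columns M"
    using h by (auto simp: columns_def col B_def bij_betw_def)
  then have "dim (columns M) = dim B"
    by (intro antisym) (auto simp: dim_insert span_0 dest: dim_subset)
  also have "independent B"
    by (rule independent_mono[OF independent_Basis]) (auto simp: B_def axis_in_Basis_iff)
  then have "dim B = card B" by (rule dim_eq_card_independent)
  also have "\<dots> = k"
    using I by (simp add: B_def card_image inj_on_def axis_eq_axis)
  finally show ?thesis by (auto simp: column_rank_def)
qed

section \<open>Outer products\<close>

definition outer :: "real^'m \<Rightarrow> real^'n \<Rightarrow> real^'n^'m" where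
  "outer u v = (\<chi> i j. u $ i * v $ j)"

lemma outer_mult: "outer u v ** A = outer u (v v* A)"
  by (simp add: outer_def matrix_matrix_mult_def vector_matrix_mult_def vec_eq_iff sum_distrib_left mult_ac)

lemma mult_outer: "A ** outer u v = outer (A *v u) v"
  by (simp add: outer_def matrix_matrix_mult_def matrix_vector_mult_def vec_eq_iff sum_distrib_left mult_ac)

lemma outer_mult_vector: "outer u v *v x = (v \<bullet> x) *\<^sub>R u"
  by (simp add: outer_def matrix_vector_mult_def inner_vec_def vec_eq_iff sum_distrib_left mult_ac)

lemma outer_scaleR_left: "outer (c *\<^sub>R u) v = c *\<^sub>R outer u v"
  by (simp add: outer_def vec_eq_iff)

lemma outer_0: "outer 0 v = 0" "outer u 0 = 0"
  by (simp_all add: outer_def vec_eq_iff)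

text \<open>Reduces the vanishing of a quadratic term to the vanishing of a single scalar.\<close>

lemma outer_sandwich: "outer u v ** A ** outer u v = (v \<bullet> (A *v u)) *\<^sub>R outer u v"
  by (simp add: mult_outer)
    (simp add: outer_scaleR_left outer_mult_vector flip: matrix_vector_mul_assoc)

lemma outer_eq_0_iff: "outer u v = 0 \<longleftrightarrow> u = 0 \<or> v = 0"
  by (auto simp: outer_def vec_eq_iff)

lemma outer_square: "v \<bullet> u = 0 \<Longrightarrow> outer u v ** outer u v = 0"
  by (simp add: mult_outer outer_mult_vector outer_0)

section \<open>A connection forces full rank on both sides\<close>

lemma connection_fixed_rank_space_imp_rows:
  fixes \<omega> :: "real^'n^'m \<Rightarrow> real^'n^'m \<Rightarrow> (real^'m^'m) \<times> (real^'n^'n)"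
  assumes \<omega>: "connection (fixed_rank_space k) \<omega>" and k: "1 \<le> k" "k \<le> CARD('m)" "k \<le> CARD('n)"
  shows "CARD('m) = k"
proof (rule ccontr)
  assume neq: "CARD('m) \<noteq> k"
  obtain M :: "real^'n^'m" where M: "rank M = k" using ex_matrix_of_rank k by blast
  have "rank (transpose M) \<noteq> CARD('m)" using rank_transpose[of M] M neq by simp
  then obtain u where u: "u \<noteq> 0" "u v* M = 0"
    using matrix_nonfull_linear_equations_eq[of "transpose M"] by auto
  \<comment> \<open>Positivity of the rank enters here: it provides the nonzero vector
    \<open>v\<close> in the image of \<open>M\<close>.\<close>
  have "M \<noteq> 0" using M k(1) rank_0 by fastforce
  then obtain w where w: "M *v w \<noteq> 0"
    by (metis matrix_eq matrix_vector_mult_0)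
  define v where "v = M *v w"
  have uM: "u \<bullet> (M *v x) = 0" for x using u(2) by (simp flip: dot_lmul_matrix)
  \<comment> \<open>\<open>f\<close> sends \<open>w\<close> to
    \<open>(v \<bullet> v) *\<^sub>R u\<close>, which lies outside the image of \<open>M\<close>.
    Since \<open>u\<close> is orthogonal to \<open>v\<close>, \<open>outer u v\<close> has square
    zero, and so the rank is constant along the line.\<close>
  define f where "f = outer u v ** M"
  obtain \<xi> \<eta> where \<xi>\<eta>: "\<omega> M f = (\<xi>, \<eta>)" by fastforce
  have line: "rank (M + t *\<^sub>R f) = k" for t
  proof -
    have "M + t *\<^sub>R f = (mat 1 + t *\<^sub>R outer u v) ** M ** mat 1"
      by (simp add: f_def matrix_mult.add_left matrix_mult.scaleR_left)
    moreover have "invertible (mat 1 + t *\<^sub>R outer u v)"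
      using uM[of w] by (intro square_zero_imp_unipotent outer_square) (simp add: v_def inner_commute)
    ultimately show ?thesis
      using rank_mult_invertible[OF _ invertible_mat_1, of "mat 1 + t *\<^sub>R outer u v" M] by (simp add: M)
  qed
  \<comment> \<open>The isotropy element uses the transpose of the matrix that defines
    \<open>f\<close>; its second component is trivial.\<close>
  have "outer v u ** M = 0" by (simp add: outer_mult u(2) outer_0)
  moreover have "outer v u ** outer v u = 0" using uM[of w] by (simp add: outer_square v_def)
  ultimately have "outer v u ** \<xi> ** outer v u = 0"
    using connection_square_zero(1)[OF \<omega> line, of "outer v u" 0] by (simp add: \<xi>\<eta>)
  then have "u \<bullet> (\<xi> *v v) = 0"
    using w u(1) by (simp add: outer_sandwich outer_eq_0_iff v_def)
  moreover have "f \<in> tangent_space {M. rank M = k} M"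
    using curve_at_line[of M f] line by simp
  then have "\<xi> ** M - M ** \<eta> = f"
    using \<omega> M inf_action_fixed_rank_space[of k "(\<xi>, \<eta>)" M] \<xi>\<eta>
    unfolding connection_def points_fixed_rank_space by force
  \<comment> \<open>After evaluation at \<open>w\<close>, pairing with \<open>u\<close> removes the
    \<open>\<eta>\<close> term, because \<open>u\<close> is orthogonal to the image of
    \<open>M\<close>.\<close>
  then have "(\<xi> ** M - M ** \<eta>) *v w = f *v w" by simp
  then have "\<xi> *v v - M *v (\<eta> *v w) = (v \<bullet> v) *\<^sub>R u"
    by (simp add: f_def v_def matrix_vector_mult_diff_rdistrib outer_mult_vector flip: matrix_vector_mul_assoc)
  then have "u \<bullet> (\<xi> *v v - M *v (\<eta> *v w)) = (v \<bullet> v) * (u \<bullet> u)" by simp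
  ultimately show False
    using u(1) w by (simp add: inner_diff_right uM v_def)
qed

text \<open>The right factor now carries the contradiction: \<open>u\<close> lies in the kernel of
  \<open>M\<close>, \<open>v\<close> in its row space, and the isotropy element comes from
  \<open>F2 = outer u v\<close> with \<open>F1 = 0\<close>.\<close>

lemma connection_fixed_rank_space_imp_columns:
  fixes \<omega> :: "real^'n^'m \<Rightarrow> real^'n^'m \<Rightarrow> (real^'m^'m) \<times> (real^'n^'n)"
  assumes \<omega>: "connection (fixed_rank_space k) \<omega>" and k: "1 \<le> k" "k \<le> CARD('m)" "k \<le> CARD('n)"
  shows "CARD('n) = k"
proof (rule ccontr)
  assume neq: "CARD('n) \<noteq> k"
  obtain M :: "real^'n^'m" where M: "rank M = k" using ex_matrix_of_rank k by blast
  obtain u where u: "u \<noteq> 0" "M *v u = 0"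
    using matrix_nonfull_linear_equations_eq[of M] M neq by auto
  have "transpose M \<noteq> 0" using M k(1) rank_0 rank_transpose[of M] by fastforce
  then obtain w where w: "w v* M \<noteq> 0"
    by (metis matrix_eq matrix_vector_mult_0 transpose_matrix_vector)
  define v where "v = w v* M"
  have vu: "v \<bullet> u = 0" using u(2) by (simp add: v_def dot_lmul_matrix)
  define f where "f = M ** outer v u"
  obtain \<xi> \<eta> where \<xi>\<eta>: "\<omega> M f = (\<xi>, \<eta>)" by fastforce
  have line: "rank (M + t *\<^sub>R f) = k" for t
  proof -
    have "M + t *\<^sub>R f = mat 1 ** M ** (mat 1 + t *\<^sub>R outer v u)"
      by (simp add: f_def matrix_mult.add_right matrix_mult.scaleR_right)
    moreover have "invertible (mat 1 + t *\<^sub>R outer v u)"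
      using vu by (intro square_zero_imp_unipotent outer_square) (simp add: inner_commute)
    ultimately show ?thesis
      using rank_mult_invertible[OF invertible_mat_1, of "mat 1 + t *\<^sub>R outer v u" M] by (simp add: M)
  qed
  have "M ** outer u v = 0" by (simp add: mult_outer u(2) outer_0)
  moreover have "outer u v ** outer u v = 0" using vu by (rule outer_square)
  ultimately have "outer u v ** \<eta> ** outer u v = 0"
    using connection_square_zero(2)[OF \<omega> line, of 0 "outer u v"] by (simp add: \<xi>\<eta>)
  then have "v \<bullet> (\<eta> *v u) = 0"
    using w u(1) by (simp add: outer_sandwich outer_eq_0_iff v_def)
  moreover have "f \<in> tangent_space {M. rank M = k} M"
    using curve_at_line[of M f] line by simp
  then have "\<xi> ** M - M ** \<eta> = f"
    using \<omega> M inf_action_fixed_rank_space[of k "(\<xi>, \<eta>)" M] \<xi>\<eta>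
    unfolding connection_def points_fixed_rank_space by force
  \<comment> \<open>Evaluation at \<open>u\<close> removes the \<open>\<xi>\<close> term. Pairing
    with \<open>w\<close> then turns the left side into
    \<open>- (v \<bullet> (\<eta> *v u))\<close>, which is 0, and the right side into a product of
    two positive squares.\<close>
  then have "(\<xi> ** M - M ** \<eta>) *v u = f *v u" by simp
  then have "- (M *v (\<eta> *v u)) = (u \<bullet> u) *\<^sub>R (M *v v)"
    by (simp add: f_def u(2) matrix_vector_mult_diff_rdistrib outer_mult_vector
        matrix_vector_mult_scaleR flip: matrix_vector_mul_assoc)
  then have "w \<bullet> (- (M *v (\<eta> *v u))) = (u \<bullet> u) * (v \<bullet> v)"
    by (simp add: v_def dot_lmul_matrix)
  ultimately show False
    using u(1) w by (simp add: v_def flip: dot_lmul_matrix)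
qed


subsection \<open>Invertible matrices\<close>

text \<open>The index types have equal size but may differ. Full rank gives a left inverse by
  injectivity and a right inverse by surjectivity, and the two coincide.\<close>

lemma rank_eq_iff_invertible:
  fixes M :: "real^'n^'m"
  assumes "CARD('m) = k" "CARD('n) = k"
  shows "rank M = k \<longleftrightarrow> invertible M"
proof
  assume "rank M = k"
  then obtain A B where A: "A ** M = mat 1" and B: "M ** B = mat 1"
    using assms full_rank_injective[of M] full_rank_surjective[of M]
      matrix_left_invertible_injective[of M] matrix_right_invertible_surjective[of M] by auto
  have "A = A ** (M ** B)" using B by simp
  also have "\<dots> = B" by (simp add: matrix_mul_assoc A)
  finally have "A = B" .
  with A B show "invertible M" unfolding invertible_def by metis
next
  assume "invertible M"
  then show "rank M = k"
    using assms full_rank_injective[of M] by (simp add: inj_matrix_vector_mult)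
qed

lemma matrix_inv_mult:
  "invertible A \<Longrightarrow> invertible B \<Longrightarrow> matrix_inv (A ** B) = matrix_inv B ** matrix_inv A"
  by (rule matrix_inv_unique; simp add: matrix_mul_assoc matrix_inv; simp add: matrix_inv flip: matrix_mul_assoc)

lemma matrix_inv_matrix_inv: "invertible A \<Longrightarrow> matrix_inv (matrix_inv A) = A"
  by (simp add: matrix_inv_unique matrix_inv)

text \<open>For square matrices this is the right-invariant Maurer-Cartan form, placed in the left
  factor. The reductive complement is the whole Lie algebra of that factor.\<close>

lemma connection_invertible:
  fixes k :: nat
  assumes k: "CARD('m) = k" "CARD('n) = k"
  shows "connection (fixed_rank_space k :: ((real^'m^'m) \<times> (real^'n^'n), real^'n^'m) homogeneous_space)
    (\<lambda>M f. (f ** matrix_inv M, 0))" (is "connection ?X ?\<omega>")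
proof -
  let ?S = "{M :: real^'n^'m. invertible M}"
  have pts: "points ?X = ?S"
    by (simp add: points_fixed_rank_space rank_eq_iff_invertible[OF k])
  \<comment> \<open>The field of linear maps that \<open>one_form\<close> asks for is
    \<open>L\<close> composed with inversion; it is smooth because \<open>L\<close> is linear in
    \<open>N\<close>.\<close>
  define L where "L N = Blinfun (\<lambda>f :: real^'n^'m. (f ** N, 0 :: real^'n^'n))" for N :: "real^'m^'n"
  have bl: "bounded_linear (\<lambda>f :: real^'n^'m. (f ** N, 0 :: real^'n^'n))" for N :: "real^'m^'n"
    by (intro bounded_linear_Pair matrix_mult.bounded_linear_left bounded_linear_zero)
  have L: "blinfun_apply (L N) f = (f ** N, 0)" for N f
    unfolding L_def by (simp add: bounded_linear_Blinfun_apply[OF bl])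
  have "bounded_linear L"
    unfolding linear_conv_bounded_linear[symmetric]
    by (rule linearI; rule blinfun_eqI)
      (simp_all add: L blinfun.add_left blinfun.scaleR_left matrix_mult.add_right matrix_mult.scaleR_right)
  then have "smooth_on (\<lambda>M. L (matrix_inv M)) ?S"
    using smooth_on_matrix_inv unfolding smooth_on_def
    by (blast intro: C_k_on_bounded_linear open_invertible)
  then have "one_form ?S UNIV ?\<omega>"
    unfolding one_form_def using open_invertible
    by (auto simp: matrix_mult.add_left matrix_mult.scaleR_left L
        intro!: exI[of _ ?S] exI[of _ "\<lambda>M. L (matrix_inv M)"])
  moreover have "inf_action ?X (?\<omega> M f) M = f" if "M \<in> ?S" for M f
    using that by (simp add: inf_action_fixed_rank_space matrix_inv flip: matrix_mul_assoc)
  moreover have "?\<omega> (action ?X g M) (tangent_map ?S (action ?X g) M f) = Ad (GL \<times>\<times> GL) g (?\<omega> M f)"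
    if g: "g \<in> carrier (GL \<times>\<times> GL)" and M: "M \<in> ?S" and f: "f \<in> tangent_space ?S M" for g M f
  proof -
    obtain A B where AB: "g = (A, B)" "invertible A" "invertible B"
      using g by (cases g) (auto simp: carrier_GL)
    \<comment> \<open>\<open>B\<close> cancels, and what remains is conjugation by \<open>A\<close>,
      the first component of the adjoint action.\<close>
    have "A ** f ** matrix_inv B ** matrix_inv (A ** M ** matrix_inv B) = A ** (f ** matrix_inv M) ** matrix_inv A"
    proof -
      have "matrix_inv (A ** M ** matrix_inv B) = B ** (matrix_inv M ** matrix_inv A)"
        using AB M by (simp add: matrix_inv_mult invertible_mult invertible_matrix_inv matrix_inv_matrix_inv)
      then have "A ** f ** matrix_inv B ** matrix_inv (A ** M ** matrix_inv B)
          = A ** f ** (matrix_inv B ** B) ** (matrix_inv M ** matrix_inv A)"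
        by (simp add: matrix_mul_assoc)
      then show ?thesis using AB by (simp add: matrix_inv matrix_mul_assoc)
    qed
    then show ?thesis
      using AB f by (simp add: tangent_map_fixed_rank_space action_fixed_rank_space Ad_GL_prod)
  qed
  ultimately show ?thesis
    unfolding connection_def pts sym_group_fixed_rank_space lie_algebra_GL_prod by blast
qed

section \<open>Change of index types\<close>

definition reindex :: "('k \<Rightarrow> 'm) \<Rightarrow> ('l \<Rightarrow> 'n) \<Rightarrow> real^'n^'m \<Rightarrow> real^'l^'k" where
  "reindex p q M = (\<chi> i j. M $ p i $ q j)"

lemma bounded_linear_reindex: "bounded_linear (reindex p q)"
  unfolding linear_conv_bounded_linear[symmetric]
  by (rule linearI) (simp_all add: reindex_def vec_eq_iff)

lemma reindex_reindex: "reindex p q (reindex p' q' M) = reindex (p' \<circ> p) (q' \<circ> q) M"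
  by (simp add: reindex_def)

lemma reindex_id: "reindex id id M = M"
  by (simp add: reindex_def)

text \<open>The bijection \<open>q\<close> is a substitution in the sum over the inner
  index.\<close>

lemma reindex_mult:
  assumes "bij q"
  shows "reindex p q M ** reindex q r N = reindex p r (M ** N)"
  using sum.reindex_bij_betw[OF assms, of "\<lambda>k. M $ p i $ k * N $ k $ r j" for i j]
  by (simp add: reindex_def matrix_matrix_mult_def vec_eq_iff)

lemma reindex_mat_1: "bij p \<Longrightarrow> reindex p p (mat 1) = mat 1"
  by (auto simp: reindex_def mat_def vec_eq_iff dest: bij_is_inj injD)

lemma reindex_invertible:
  assumes "bij p" "bij q" "invertible M"
  shows "invertible (reindex p q M)" "matrix_inv (reindex p q M) = reindex q p (matrix_inv M)"
proof -
  have "reindex p q M ** reindex q p (matrix_inv M) = mat 1"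
    "reindex q p (matrix_inv M) ** reindex p q M = mat 1"
    using assms by (simp_all add: reindex_mult matrix_inv reindex_mat_1)
  then show "invertible (reindex p q M)" "matrix_inv (reindex p q M) = reindex q p (matrix_inv M)"
    by (auto simp: invertible_def intro: matrix_inv_unique)
qed

lemma smooth_map_on_bounded_linear: "bounded_linear F \<Longrightarrow> smooth_map_on S F"
  unfolding smooth_map_on_def by (blast intro: smooth_on_bounded_linear open_UNIV)

text \<open>\<open>inv_into S F\<close> agrees with \<open>G\<close> on \<open>T\<close>, and
  \<open>smooth_map_on\<close> asks only for a smooth extension that agrees on
  \<open>T\<close>.\<close>

lemma diffeo_bounded_linear:
  assumes lin: "bounded_linear F" "bounded_linear G"
    and "\<And>x. x \<in> S \<Longrightarrow> F x \<in> T" "\<And>y. y \<in> T \<Longrightarrow> G y \<in> S" "\<And>x. G (F x) = x" "\<And>y. F (G y) = y"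
  shows "diffeo S T F"
proof -
  have bij: "bij_betw F S T"
    using assms by (intro bij_betw_byWitness[where f' = G]) auto
  have "inv_into S F y = G y" if "y \<in> T" for y
    using assms that by (intro inv_into_f_eq bij_betw_imp_inj_on[OF bij]) auto
  then have "smooth_map_on T (inv_into S F)"
    using smooth_on_bounded_linear[OF open_UNIV lin(2)] unfolding smooth_map_on_def by fastforce
  with bij show ?thesis
    unfolding diffeo_def by (blast intro: smooth_map_on_bounded_linear lin)
qed

lemma fixed_rank_space_isomorphic_cartan_schouten:
  fixes k :: nat
  assumes k: "CARD('m::finite) = k" "CARD('n::finite) = k" "CARD('k::finite) = k"
  shows "isomorphic_homogeneous_spaces
    (fixed_rank_space k :: ((real^'m^'m) \<times> (real^'n^'n), real^'n^'m) homogeneous_space)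
    (cartan_schouten (GL :: (real^'k^'k) monoid))"
proof -
  obtain p :: "'k \<Rightarrow> 'm" where p: "bij p"
    using finite_same_card_bij[of "UNIV :: 'k set" "UNIV :: 'm set"] k by auto
  obtain q :: "'k \<Rightarrow> 'n" where q: "bij q"
    using finite_same_card_bij[of "UNIV :: 'k set" "UNIV :: 'n set"] k by auto
  define p' q' where "p' = inv_into UNIV p" and "q' = inv_into UNIV q"
  have inv: "bij (p')" "bij (q')" "p \<circ> p' = id" "p' \<circ> p = id" "q \<circ> q' = id" "q' \<circ> q = id"
    using p q by (auto simp: p'_def q'_def bij_imp_bij_inv surj_iff[symmetric] inj_iff[symmetric] bij_is_inj bij_is_surj)
  \<comment> \<open>Points have their rows relabelled by \<open>p\<close> and their columns by
    \<open>q\<close>. Relabelling the left group factor by \<open>p\<close> and the right one by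
    \<open>q\<close> makes \<open>reindex p q\<close> equivariant.\<close>
  define \<phi> :: "(real^'m^'m) \<times> (real^'n^'n) \<Rightarrow> (real^'k^'k) \<times> (real^'k^'k)"
    where "\<phi> g = (reindex p p (fst g), reindex q q (snd g))" for g
  define \<psi> :: "(real^'k^'k) \<times> (real^'k^'k) \<Rightarrow> (real^'m^'m) \<times> (real^'n^'n)"
    where "\<psi> g = (reindex (p') (p') (fst g), reindex (q') (q') (snd g))" for g
  have diff\<phi>: "diffeo (carrier (GL \<times>\<times> GL)) (carrier (GL \<times>\<times> GL)) \<phi>"
  proof (rule diffeo_bounded_linear[where G = \<psi>])
    show "bounded_linear \<phi>" "bounded_linear \<psi>"
      unfolding \<phi>_def \<psi>_def
      by (intro bounded_linear_Pair bounded_linear_compose[OF bounded_linear_reindex]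
          bounded_linear_fst bounded_linear_snd)+
  qed (auto simp: \<phi>_def \<psi>_def carrier_GL reindex_invertible p q inv reindex_reindex reindex_id)
  moreover have "\<phi> \<in> hom (GL \<times>\<times> GL) (GL \<times>\<times> GL)"
    by (auto simp: hom_def \<phi>_def carrier_GL mult_GL reindex_invertible reindex_mult p q)
  ultimately have "\<phi> \<in> iso (GL \<times>\<times> GL) (GL \<times>\<times> GL)"
    by (simp add: iso_def diffeo_def)
  moreover have "diffeo {M :: real^'n^'m. invertible M} (carrier (GL :: (real^'k^'k) monoid)) (reindex p q)"
    by (rule diffeo_bounded_linear[where G = "reindex (p') (q')"])
      (auto simp: carrier_GL reindex_invertible bounded_linear_reindex p q inv reindex_reindex reindex_id)
  moreover have "reindex p q (A ** M ** matrix_inv B)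
      = reindex p p A ** reindex p q M ** inv\<^bsub>GL\<^esub> (reindex q q B)"
    if "invertible B" for A B and M :: "real^'n^'m"
    using that by (simp add: inv_GL reindex_invertible reindex_mult p q)
  ultimately show ?thesis
    using diff\<phi> unfolding isomorphic_homogeneous_spaces_def
    by (intro exI[of _ \<phi>] exI[of _ "reindex p q"])
      (auto simp: points_fixed_rank_space sym_group_fixed_rank_space action_fixed_rank_space
        rank_eq_iff_invertible[OF k(1,2)] cartan_schouten_def carrier_GL mult_GL \<phi>_def)
qed

text \<open>The bounds on \<open>k\<close> exclude degenerate spaces: for \<open>k = 0\<close> the
  manifold is a single point and the zero form is a connection; for \<open>k\<close> above either
  dimension it is empty and every form is one.\<close>

theorem proposition5p7:
  fixes k :: nat
  assumes "1 \<le> k" and "k \<le> CARD('m::finite)" and "k \<le> CARD('n::finite)"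
  shows "(has_connection
            (fixed_rank_space k :: ((real^'m^'m) \<times> (real^'n^'n), real^'n^'m) homogeneous_space)
          \<longleftrightarrow> CARD('m) = k \<and> CARD('n) = k) \<and>
         (CARD('m) = k \<and> CARD('n) = k \<and> CARD('k::finite) = k \<longrightarrow>
            isomorphic_homogeneous_spaces
              (fixed_rank_space k :: ((real^'m^'m) \<times> (real^'n^'n), real^'n^'m) homogeneous_space)
              (cartan_schouten (GL :: (real^'k^'k) monoid)))"
  using assms connection_fixed_rank_space_imp_rows connection_fixed_rank_space_imp_columns
    connection_invertible fixed_rank_space_isomorphic_cartan_schouten
  unfolding has_connection_def by blast

end
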